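(* Let $(X,d)$ be a complete CAT(0) space and let $A$ and $B$ be two convex, closed, nonempty subsets of $X$. Let $\lambda \in (0,1)$ and let $T : X \to X$ be defined by $Tx := (1-\lambda)P_Ax + \lambda P_Bx$ for all $x\in X$. Assume that $S_{A,B} \neq \emptyset$. Then for any $x \in X$ there is a pair $(a,b) \in S_{A,B}$ such that the Picard iteration $(T^nx)_n$ of $T$ starting with $x$ $\Delta$-converges to $p:=(1-\lambda)a + \lambda b$.
   Context: A geodesic joining $x,y$ in a metric space $(X,d)$ is a map $\gamma:[0,1]\to X$ with $\gamma(0)=x$, $\gamma(1)=y$ and $d(\gamma(t),\gamma(t'))=|t-t'|\,d(x,y)$ for all $t,t'\in[0,1]$; $(X,d)$ is geodesic if any two points are joined by a geodesic. A CAT(0) space is a geodesic space such that for every geodesic $\gamma:[0,1]\to X$, every $z\in X$ and $t\in[0,1]$, $d^2(z,\gamma(t))\le (1-t)d^2(z,\gamma(0))+t\,d^2(z,\gamma(1))-t(1-t)d^2(\gamma(0),\gamma(1))$. Geodesics in a CAT(0) space are unique, and $(1-t)x+ty$ denotes the point $\gamma(t)$ on the unique geodesic $\gamma$ joining $x$ to $y$; a subset is convex if it contains the geodesic between any two of its points. For a nonempty closed convex subset $C$ of $X$, $P_C:X\to X$ is the metric projection: $P_Cx$ is the unique $z\in C$ with $d(x,z)\le d(x,w)$ for all $w\in C$. Put $d(A,B):=\inf_{(x,y)\in A\times B}d(x,y)$, and let $S_{A,B}$ be the set of best approximation pairs, i.e. of all $(x^*,y^* )\in A\times B$ with $d(x^*,y^*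 )=d(A,B)$. For a bounded sequence $(x_n)$ in a complete CAT(0) space $X$, put $r((x_n)):=\inf_{y\in X}\limsup_{n\to\infty}d(y,x_n)$ and $A((x_n)):=\{c\in X\mid \limsup_{n\to\infty}d(c,x_n)=r((x_n))\}$, the set of asymptotic centers of $(x_n)$ (known to be always a singleton). A bounded sequence $(x_n)$ $\Delta$-converges to $x\in X$ if for every subsequence $(x_{n_k})$ of $(x_n)$, $A((x_{n_k}))=\{x\}$. *)

theory Defs
  imports "HOL-Analysis.Analysis"
begin

section \<open>CAT(0) spaces\<close>

text \<open>A geodesic is a map on the interval from 0 to 1; it is represented by a function on all
  reals whose values outside that interval are irrelevant.\<close>

definition (in metric_space) geodesic_joining :: "(real \<Rightarrow> 'a) \<Rightarrow> 'a \<Rightarrow> 'a \<Rightarrow> bool" where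
  "geodesic_joining \<gamma> x y \<longleftrightarrow> \<gamma> 0 = x \<and> \<gamma> 1 = y \<and>
     (\<forall>t\<in>{0..1}. \<forall>t'\<in>{0..1}. dist (\<gamma> t) (\<gamma> t') = \<bar>t - t'\<bar> * dist x y)"

class geodesic_space = metric_space +
  assumes geodesic_exists: "\<exists>\<gamma>. geodesic_joining \<gamma> x y"

class CAT0_space = geodesic_space +
  assumes CAT0_inequality:
    "\<lbrakk>geodesic_joining \<gamma> x y; 0 \<le> t; t \<le> 1\<rbrakk> \<Longrightarrow>
      (dist z (\<gamma> t))\<^sup>2 \<le>
        (1 - t) * (dist z (\<gamma> 0))\<^sup>2 + t * (dist z (\<gamma> 1))\<^sup>2 - t * (1 - t) * (dist (\<gamma> 0) (\<gamma> 1))\<^sup>2"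

lemma geodesic_unique:
  fixes \<gamma> \<gamma>' :: "real \<Rightarrow> 'a::CAT0_space"
  assumes g: "geodesic_joining \<gamma> x y" and g': "geodesic_joining \<gamma>' x y" and t: "0 \<le> t" "t \<le> 1"
  shows "\<gamma>' t = \<gamma> t"
proof -
  have ends: "\<gamma> 0 = x" "\<gamma> 1 = y" "\<gamma>' 0 = x" "\<gamma>' 1 = y"
    using g g' unfolding geodesic_joining_def by blast+
  have t01: "t \<in> {0..1}" "(0::real) \<in> {0..1}" "(1::real) \<in> {0..1}"
    using t by simp_all
  have iso: "\<forall>s\<in>{0..1}. \<forall>s'\<in>{0..1}. dist (\<gamma>' s) (\<gamma>' s') = \<bar>s - s'\<bar> * dist x y"
    using g' unfolding geodesic_joining_def by blast
  have d: "dist (\<gamma>' t) x = t * dist x y" "dist (\<gamma>' t) y = (1 - t) * dist x y"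
    using iso[rule_format, OF t01(1,2)] iso[rule_format, OF t01(1,3)] t
    unfolding ends by simp_all
  have "(dist (\<gamma>' t) (\<gamma> t))\<^sup>2 \<le>
      (1 - t) * (t * dist x y)\<^sup>2 + t * ((1 - t) * dist x y)\<^sup>2 - t * (1 - t) * (dist x y)\<^sup>2"
    using CAT0_inequality[OF g t, of "\<gamma>' t"] unfolding ends d .
  also have "\<dots> = 0"
    by (simp add: power2_eq_square algebra_simps)
  finally show ?thesis by simp
qed

text \<open>The point written $(1-t)x + ty$, for $t$ between 0 and 1.\<close>

definition geodesic_point :: "real \<Rightarrow> 'a \<Rightarrow> 'a \<Rightarrow> 'a::CAT0_space" where
  "geodesic_point t x y = (THE z. \<exists>\<gamma>. geodesic_joining \<gamma> x y \<and> z = \<gamma> t)"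

lemma geodesic_point_eq:
  fixes \<gamma> :: "real \<Rightarrow> 'a::CAT0_space"
  assumes "geodesic_joining \<gamma> x y" "0 \<le> t" "t \<le> 1"
  shows "geodesic_point t x y = \<gamma> t"
  unfolding geodesic_point_def
proof (rule the_equality)
  show "\<exists>\<gamma>'. geodesic_joining \<gamma>' x y \<and> \<gamma> t = \<gamma>' t"
    using assms(1) by (intro exI[of _ \<gamma>] conjI refl)
next
  fix z assume "\<exists>\<gamma>'. geodesic_joining \<gamma>' x y \<and> z = \<gamma>' t"
  then obtain \<gamma>' where g': "geodesic_joining \<gamma>' x y" and z: "z = \<gamma>' t"
    by (elim exE conjE)
  from geodesic_unique[OF assms(1) g' assms(2,3)] z show "z = \<gamma> t" by simp
qed

definition geodesically_convex :: "'a::CAT0_space set \<Rightarrow> bool" where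
  "geodesically_convex C \<longleftrightarrow>
     (\<forall>x\<in>C. \<forall>y\<in>C. \<forall>\<gamma>. geodesic_joining \<gamma> x y \<longrightarrow> (\<forall>t\<in>{0..1}. \<gamma> t \<in> C))"


section \<open>Metric projections and best approximation pairs\<close>

definition metric_proj :: "'a::metric_space set \<Rightarrow> 'a \<Rightarrow> 'a" where
  "metric_proj C x = (THE z. z \<in> C \<and> (\<forall>w\<in>C. dist x z \<le> dist x w))"

definition best_approx_pairs :: "'a::metric_space set \<Rightarrow> 'a set \<Rightarrow> ('a \<times> 'a) set" where
  "best_approx_pairs A B = {(a, b) \<in> A \<times> B. dist a b = setdist A B}"


section \<open>Asymptotic centers and \<open>\<Delta>\<close>-convergence\<close>

text \<open>Limits superior are taken in the extended reals; for bounded sequences they are finite.\<close>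

definition asymptotic_radius :: "(nat \<Rightarrow> 'a::metric_space) \<Rightarrow> ereal" where
  "asymptotic_radius u = (INF y. limsup (\<lambda>n. ereal (dist y (u n))))"

definition asymptotic_centers :: "(nat \<Rightarrow> 'a::metric_space) \<Rightarrow> 'a set" where
  "asymptotic_centers u = {c. limsup (\<lambda>n. ereal (dist c (u n))) = asymptotic_radius u}"

definition Delta_converges :: "(nat \<Rightarrow> 'a::metric_space) \<Rightarrow> 'a \<Rightarrow> bool" where
  "Delta_converges u x \<longleftrightarrow> bounded (range u) \<and>
     (\<forall>s::nat \<Rightarrow> nat. strict_mono s \<longrightarrow> asymptotic_centers (u \<circ> s) = {x})"

end

theory Submission
  imports Defs
begin

text \<open>
  Write \<open>E x = (1 - lam) d(x, A)\<^sup>2 + lam d(x, B)\<^sup>2\<close>. One step of \<open>T\<close> is an averaging step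
  towards the two feet of \<open>x\<close>, and the CAT(0) inequality gives \<open>d(x, T x)\<^sup>2 \<le> E x - E (T x)\<close>
  (\<open>energy_descent\<close>). The energy thus decreases and, being nonnegative, converges along the Picard iteration, and
  the displacements \<open>d(x\<^sub>n, T x\<^sub>n)\<close> tend to zero. The map \<open>T\<close> is also nonexpansive, because metric
  projections are and because averaging along geodesics does not increase squared distances in
  the mean (\<open>dist_geodesic_points_squared_le\<close>).

  For a nonexpansive map with vanishing displacements, the asymptotic center of every subsequence
  of the iteration is a fixed point. The distance of the iteration to a fixed point decreases, so
  its limit superior along a subsequence is that along the whole sequence; hence all
  subsequences have the same asymptotic center \<open>p\<close>
  (\<open>nonexpansive_Picard_Delta_converges\<close>). The hypothesis that a best approximation pair exists enters
  here: it yields a fixed point, which keeps the iteration bounded.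

  It remains to write \<open>p\<close> in terms of a best approximation pair. Let \<open>a\<close> and \<open>b\<close> be the feet of \<open>p\<close> in
  \<open>A\<close> and \<open>B\<close>, so that \<open>p = T p\<close> lies on the geodesic from \<open>a\<close> to \<open>b\<close>. The obtuse angle at \<open>a\<close> between
  \<open>p\<close> and the set \<open>A\<close> is also the angle between \<open>b\<close> and \<open>A\<close>, so \<open>a\<close> is the foot of \<open>b\<close> as well, and
  symmetrically \<open>b\<close> is the foot of \<open>a\<close>. Two points that are each other's feet realize the distance of
  \<open>A\<close> and \<open>B\<close> (\<open>mutual_projections_best_approx\<close>).

  Two tools serve throughout. The first is the inequality bounding the sum of the squared
  diagonals of a quadrilateral by that of its squared sides. The second is the existence
  and quadratic growth of minimizers of strongly convex functions, which gives both the metric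
  projections and the asymptotic centers.
\<close>

section \<open>Geodesics and the quadrilateral inequality\<close>

lemma
  fixes x y :: "'a::CAT0_space"
  assumes t: "0 \<le> t" "t \<le> 1"
  shows dist_geodesic_point_left: "dist x (geodesic_point t x y) = t * dist x y"
    and dist_geodesic_point_right: "dist y (geodesic_point t x y) = (1 - t) * dist x y"
    and CAT0_geodesic_point:
      "(dist z (geodesic_point t x y))\<^sup>2 \<le>
         (1 - t) * (dist z x)\<^sup>2 + t * (dist z y)\<^sup>2 - t * (1 - t) * (dist x y)\<^sup>2"
proof -
  obtain \<gamma> where g: "geodesic_joining \<gamma> x y"
    using geodesic_exists by blast
  have p: "geodesic_point t x y = \<gamma> t"
    using geodesic_point_eq[OF g t] .
  have ends: "\<gamma> 0 = x" "\<gamma> 1 = y"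
    and iso: "\<forall>t\<in>{0..1}. \<forall>t'\<in>{0..1}. dist (\<gamma> t) (\<gamma> t') = \<bar>t - t'\<bar> * dist x y"
    using g unfolding geodesic_joining_def by blast+
  show "dist x (geodesic_point t x y) = t * dist x y"
    using iso[rule_format, of 0 t] t by (simp add: p ends)
  show "dist y (geodesic_point t x y) = (1 - t) * dist x y"
    using iso[rule_format, of 1 t] t by (simp add: p ends)
  show "(dist z (geodesic_point t x y))\<^sup>2 \<le>
      (1 - t) * (dist z x)\<^sup>2 + t * (dist z y)\<^sup>2 - t * (1 - t) * (dist x y)\<^sup>2"
    using CAT0_inequality[OF g t, of z] by (simp add: p ends)
qed

lemma geodesically_convexD:
  assumes "geodesically_convex C" "x \<in> C" "y \<in> C" "0 \<le> t" "t \<le> 1"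
  shows "geodesic_point t x y \<in> C"
proof -
  obtain \<gamma> where g: "geodesic_joining \<gamma> x y"
    using geodesic_exists by blast
  then show ?thesis
    using assms geodesic_point_eq[OF g assms(4,5)] unfolding geodesically_convex_def by auto
qed

lemma geodesically_convex_UNIV: "geodesically_convex UNIV"
  by (simp add: geodesically_convex_def)

text \<open>The two points \<open>x\<close> and \<open>y\<close> are compared with the midpoint \<open>m\<close> of the other diagonal:
  the CAT(0) inequality bounds their squared distances to \<open>m\<close>, and
  \<open>d(x, y)\<^sup>2 \<le> 2 d(x, m)\<^sup>2 + 2 d(y, m)\<^sup>2\<close>.\<close>

lemma quadrilateral_inequality:
  fixes p q x y :: "'a::CAT0_space"
  shows "(dist x y)\<^sup>2 + (dist p q)\<^sup>2 \<le>
    (dist x p)\<^sup>2 + (dist x q)\<^sup>2 + (dist y p)\<^sup>2 + (dist y q)\<^sup>2"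
proof -
  define m where "m = geodesic_point (1/2) p q"
  have m: "(dist z m)\<^sup>2 \<le> (dist z p)\<^sup>2 / 2 + (dist z q)\<^sup>2 / 2 - (dist p q)\<^sup>2 / 4" for z
    using CAT0_geodesic_point[of "1/2" z p q] by (simp add: m_def)
  have "(dist x y)\<^sup>2 \<le> (dist x m + dist y m)\<^sup>2"
    by (intro power_mono dist_triangle2) simp
  also have "\<dots> \<le> 2 * (dist x m)\<^sup>2 + 2 * (dist y m)\<^sup>2"
    using sum_squares_bound[of "dist x m" "dist y m"] by (simp add: power2_sum)
  finally show ?thesis using m[of x] m[of y] by linarith
qed

text \<open>A squared form of the convexity of the metric, sufficient to see that \<open>T\<close> is nonexpansive.
  Applying the CAT(0) inequality first to one geodesic and then to the other leaves
  multiples of \<open>d(x, x')\<^sup>2\<close> and \<open>d(y, y')\<^sup>2\<close> and, with the factor \<open>t (1 - t)\<close>, the squared diagonals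
  minus the squares of the other two sides of the quadrilateral with vertices \<open>x, x', y', y\<close>. The
  quadrilateral inequality bounds that last difference by \<open>d(x, x')\<^sup>2 + d(y, y')\<^sup>2\<close>.\<close>

lemma dist_geodesic_points_squared_le:
  fixes x y x' y' :: "'a::CAT0_space"
  assumes t: "0 \<le> t" "t \<le> 1"
  shows "(dist (geodesic_point t x y) (geodesic_point t x' y'))\<^sup>2 \<le>
    (1 - t) * (dist x x')\<^sup>2 + t * (dist y y')\<^sup>2"
proof -
  define m where "m = geodesic_point t x y"
  have 1: "(dist m (geodesic_point t x' y'))\<^sup>2 \<le>
      (1 - t) * (dist m x')\<^sup>2 + t * (dist m y')\<^sup>2 - t * (1 - t) * (dist x' y')\<^sup>2"
    using CAT0_geodesic_point[OF t] .
  have 2: "(dist m z)\<^sup>2 \<le> (1 - t) * (dist x z)\<^sup>2 + t * (dist y z)\<^sup>2 - t * (1 - t) * (dist x y)\<^sup>2"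
    for z
    using CAT0_geodesic_point[OF t, of z x y] by (simp add: m_def dist_commute)
  have "(1 - t) * (dist m x')\<^sup>2 \<le>
      (1 - t) * ((1 - t) * (dist x x')\<^sup>2 + t * (dist y x')\<^sup>2 - t * (1 - t) * (dist x y)\<^sup>2)"
    using t by (intro mult_left_mono 2) simp
  moreover have "t * (dist m y')\<^sup>2 \<le>
      t * ((1 - t) * (dist x y')\<^sup>2 + t * (dist y y')\<^sup>2 - t * (1 - t) * (dist x y)\<^sup>2)"
    using t by (intro mult_left_mono 2) simp
  moreover have "t * (1 - t) * ((dist x y')\<^sup>2 + (dist y x')\<^sup>2) \<le>
      t * (1 - t) * ((dist x y)\<^sup>2 + (dist x x')\<^sup>2 + (dist y y')\<^sup>2 + (dist x' y')\<^sup>2)"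
    using t quadrilateral_inequality[of x y' y x'] 
    by (intro mult_left_mono) (simp_all add: dist_commute)
  ultimately have "(dist m (geodesic_point t x' y'))\<^sup>2 \<le>
      (1 - t) * ((1 - t) * (dist x x')\<^sup>2 + t * (dist y x')\<^sup>2 - t * (1 - t) * (dist x y)\<^sup>2)
      + t * ((1 - t) * (dist x y')\<^sup>2 + t * (dist y y')\<^sup>2 - t * (1 - t) * (dist x y)\<^sup>2)
      + t * (1 - t) * ((dist x y)\<^sup>2 + (dist x x')\<^sup>2 + (dist y y')\<^sup>2 + (dist x' y')\<^sup>2)
      - t * (1 - t) * ((dist x y')\<^sup>2 + (dist y x')\<^sup>2) - t * (1 - t) * (dist x' y')\<^sup>2"
    using 1 by linarith
  also have "\<dots> = (1 - t) * (dist x x')\<^sup>2 + t * (dist y y')\<^sup>2"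
    by algebra
  finally show ?thesis by (simp add: m_def)
qed


section \<open>Minimizers of strongly convex functions\<close>

text \<open>The modulus is normalized so that squared distance functions are strongly convex: for them
  this is the CAT(0) inequality.\<close>

definition strongly_convex_on :: "'a::CAT0_space set \<Rightarrow> ('a \<Rightarrow> real) \<Rightarrow> bool" where
  "strongly_convex_on C g \<longleftrightarrow> (\<forall>y\<in>C. \<forall>z\<in>C. \<forall>t\<in>{0..1}.
     g (geodesic_point t y z) \<le> (1 - t) * g y + t * g z - t * (1 - t) * (dist y z)\<^sup>2)"

lemma strongly_convex_onD:
  assumes "strongly_convex_on C g" "y \<in> C" "z \<in> C" "0 \<le> t" "t \<le> 1"
  shows "g (geodesic_point t y z) \<le> (1 - t) * g y + t * g z - t * (1 - t) * (dist y z)\<^sup>2"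
  using assms by (auto simp: strongly_convex_on_def)

text \<open>Comparing the minimum with the value at a point of the geodesic from \<open>c\<close> to \<open>y\<close> gives
  \<open>g c + s d(c, y)\<^sup>2 \<le> g y\<close>, where \<open>1 - s\<close> is the parameter of that point; the point then moves to \<open>c\<close>.
  For a squared distance this is the obtuse angle property of metric projections.\<close>

lemma strongly_convex_minimizer_growth:
  assumes C: "geodesically_convex C" and g: "strongly_convex_on C g"
    and c: "c \<in> C" "\<And>w. w \<in> C \<Longrightarrow> g c \<le> g w" and y: "y \<in> C"
  shows "g c + (dist c y)\<^sup>2 \<le> g y"
proof -
  have "s * (dist c y)\<^sup>2 \<le> g y - g c" if s: "0 < s" "s < 1" for s
  proof -
    have "g c \<le> g (geodesic_point (1 - s) c y)"
      using C c y s by (intro c(2) geodesically_convexD) auto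
    also have "\<dots> \<le> (1 - (1 - s)) * g c + (1 - s) * g y - (1 - s) * (1 - (1 - s)) * (dist c y)\<^sup>2"
      using s by (intro strongly_convex_onD[OF g c(1) y]) auto
    finally have "(1 - s) * (s * (dist c y)\<^sup>2) \<le> (1 - s) * (g y - g c)"
      by (simp add: algebra_simps)
    then show ?thesis using s by simp
  qed
  from field_le_mult_one_interval[OF this] show ?thesis by simp
qed

text \<open>A minimizing sequence is Cauchy: the value at the midpoint of two of its terms is at least the
  infimum, so strong convexity bounds the distance of the terms by their excess over it.\<close>

lemma strongly_convex_minimizer_exists:
  fixes C :: "'a::{CAT0_space, complete_space} set"
  assumes C: "geodesically_convex C" "closed C" "C \<noteq> {}" and g: "strongly_convex_on C g"
    and cont: "continuous_on C g" and bdd: "bdd_below (g ` C)"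
  obtains c where "c \<in> C" "\<And>w. w \<in> C \<Longrightarrow> g c \<le> g w"
proof -
  define m where "m = Inf (g ` C)"
  have m: "m \<le> g w" if "w \<in> C" for w
    unfolding m_def using bdd that by (rule cINF_lower)
  have "\<exists>w\<in>C. g w < m + inverse (real (Suc n))" for n
    using cInf_lessD[of "g ` C" "m + inverse (real (Suc n))"] C(3) by (auto simp: m_def)
  then obtain v where v: "\<And>n. v n \<in> C" "\<And>n. g (v n) < m + inverse (real (Suc n))"
    by metis
  have close: "(dist (v i) (v j))\<^sup>2 \<le> 2 * (inverse (real (Suc i)) + inverse (real (Suc j)))" for i j
  proof -
    have "m \<le> g (geodesic_point (1/2) (v i) (v j))"
      by (intro m geodesically_convexD C v) auto
    also have "\<dots> \<le> (1 - 1/2) * g (v i) + 1/2 * g (v j) - 1/2 * (1 - 1/2) * (dist (v i) (v j))\<^sup>2"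
      by (intro strongly_convex_onD[OF g v(1) v(1)]) auto
    finally show ?thesis using v(2)[of i] v(2)[of j] by simp
  qed
  have "Cauchy v"
  proof (rule metric_CauchyI)
    fix e :: real assume e: "0 < e"
    obtain N where N: "inverse (real (Suc N)) < e\<^sup>2 / 4"
      using reals_Archimedean[of "e\<^sup>2 / 4"] e by auto
    have small: "inverse (real (Suc i)) < e\<^sup>2 / 4" if "i \<ge> N" for i
      using that N by (intro le_less_trans[OF _ N]) (simp add: field_simps)
    have "dist (v i) (v j) < e" if "i \<ge> N" "j \<ge> N" for i j
    proof (rule power_less_imp_less_base[where n = 2])
      show "(dist (v i) (v j))\<^sup>2 < e\<^sup>2"
        using le_less_trans[OF close mult_strict_left_mono[OF add_strict_mono[OF small small]]] that
        by fastforce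
      show "0 \<le> e" using e by simp
    qed
    then show "\<exists>M. \<forall>i\<ge>M. \<forall>j\<ge>M. dist (v i) (v j) < e" by blast
  qed
  then obtain c where lim: "v \<longlonglongrightarrow> c"
    using Cauchy_convergent convergent_def by blast
  have c: "c \<in> C"
    using closed_sequentially[OF C(2) v(1) lim] .
  have "(\<lambda>n. g (v n)) \<longlonglongrightarrow> g c"
    using continuous_on_tendsto_compose[OF cont lim c] v(1) by simp
  moreover have "(\<lambda>n. m + inverse (real (Suc n))) \<longlonglongrightarrow> m"
    using tendsto_add[OF tendsto_const LIMSEQ_inverse_real_of_nat, of m] by simp
  ultimately have "g c \<le> m"
    by (rule LIMSEQ_le) (use v(2) less_imp_le in blast)
  with c m that show thesis by force
qed


section \<open>Metric projections\<close>

lemma strongly_convex_dist_squared: "strongly_convex_on C (\<lambda>y. (dist x y)\<^sup>2)"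
  using CAT0_geodesic_point by (auto simp: strongly_convex_on_def)

text \<open>The inequality \<open>metric_proj_obtuse\<close> says that the angle at the foot of \<open>x\<close> between \<open>x\<close> and any
  point of \<open>C\<close> is at least a right angle.\<close>

lemma metric_proj_properties:
  fixes C :: "'a::{CAT0_space, complete_space} set"
  assumes C: "geodesically_convex C" "closed C" "C \<noteq> {}"
  shows metric_proj_in: "metric_proj C x \<in> C"
    and metric_proj_obtuse:
      "w \<in> C \<Longrightarrow> (dist x (metric_proj C x))\<^sup>2 + (dist (metric_proj C x) w)\<^sup>2 \<le> (dist x w)\<^sup>2"
proof -
  let ?P = "\<lambda>z. z \<in> C \<and> (\<forall>w\<in>C. dist x z \<le> dist x w)"
  have growth: "(dist x z)\<^sup>2 + (dist z w)\<^sup>2 \<le> (dist x w)\<^sup>2" if "?P z" "w \<in> C" for z w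
    using that
    by (intro strongly_convex_minimizer_growth[OF C(1) strongly_convex_dist_squared])
      (auto intro: power_mono)
  obtain c where c: "c \<in> C" "\<And>w. w \<in> C \<Longrightarrow> (dist x c)\<^sup>2 \<le> (dist x w)\<^sup>2"
    by (rule strongly_convex_minimizer_exists[OF C strongly_convex_dist_squared[of C x]])
      (auto intro!: continuous_intros bdd_belowI[where m = 0])
  have "?P c" using c by (auto intro: power2_le_imp_le)
  moreover have "z = c" if "?P z" for z
  proof -
    have "(dist z c)\<^sup>2 \<le> 0"
      using growth[OF that c(1)] c(2)[of z] that by linarith
    then show ?thesis by simp
  qed
  ultimately have P: "?P (metric_proj C x)"
    unfolding metric_proj_def by (rule theI)
  show "metric_proj C x \<in> C" using P by blast
  show "w \<in> C \<Longrightarrow> (dist x (metric_proj C x))\<^sup>2 + (dist (metric_proj C x) w)\<^sup>2 \<le> (dist x w)\<^sup>2"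
    using growth P by blast
qed

lemma metric_proj_dist_le:
  fixes C :: "'a::{CAT0_space, complete_space} set"
  assumes "geodesically_convex C" "closed C" "w \<in> C"
  shows "(dist x (metric_proj C x))\<^sup>2 \<le> (dist x w)\<^sup>2"
proof -
  have "(dist x (metric_proj C x))\<^sup>2 + (dist (metric_proj C x) w)\<^sup>2 \<le> (dist x w)\<^sup>2"
    using assms by (intro metric_proj_obtuse) auto
  then show ?thesis
    using zero_le_power2[of "dist (metric_proj C x) w"] by linarith
qed

lemma metric_proj_eqI:
  fixes C :: "'a::{CAT0_space, complete_space} set"
  assumes C: "geodesically_convex C" "closed C" and z: "z \<in> C" "\<And>w. w \<in> C \<Longrightarrow> dist x z \<le> dist x w"
  shows "metric_proj C x = z"
proof -
  have ne: "C \<noteq> {}" using z by auto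
  have "(dist x z)\<^sup>2 \<le> (dist x (metric_proj C x))\<^sup>2"
    using z(2)[OF metric_proj_in[OF C ne, of x]] by (intro power_mono) auto
  then have "(dist (metric_proj C x) z)\<^sup>2 \<le> 0"
    using metric_proj_obtuse[OF C ne z(1), of x] by linarith
  then show ?thesis by simp
qed

text \<open>The obtuse angles at the two feet bound the diagonals of the quadrilateral formed by \<open>x\<close>,
  \<open>y\<close> and their feet from below, and the quadrilateral inequality bounds them from above.\<close>

lemma metric_proj_nonexpansive:
  fixes C :: "'a::{CAT0_space, complete_space} set"
  assumes C: "geodesically_convex C" "closed C" "C \<noteq> {}"
  shows "dist (metric_proj C x) (metric_proj C y) \<le> dist x y"
proof -
  define p q where "p = metric_proj C x" and "q = metric_proj C y"
  have "(dist x p)\<^sup>2 + (dist p q)\<^sup>2 \<le> (dist x q)\<^sup>2"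
    unfolding p_def q_def by (intro metric_proj_obtuse metric_proj_in C)
  moreover have "(dist y q)\<^sup>2 + (dist q p)\<^sup>2 \<le> (dist y p)\<^sup>2"
    unfolding p_def q_def by (intro metric_proj_obtuse metric_proj_in C)
  moreover have "(dist x q)\<^sup>2 + (dist y p)\<^sup>2 \<le>
      (dist x y)\<^sup>2 + (dist x p)\<^sup>2 + (dist y q)\<^sup>2 + (dist q p)\<^sup>2"
    using quadrilateral_inequality[of x q y p] by (simp add: dist_commute)
  ultimately have "(dist p q)\<^sup>2 \<le> (dist x y)\<^sup>2" by linarith
  then show ?thesis by (simp add: p_def q_def)
qed


section \<open>Asymptotic centers\<close>

text \<open>A real-valued version of the function whose minimizers are the asymptotic centers; it carries
  information only for bounded sequences, for which the limit superior is finite.\<close>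

definition limsup_dist :: "(nat \<Rightarrow> 'a::metric_space) \<Rightarrow> 'a \<Rightarrow> real" where
  "limsup_dist u y = real_of_ereal (limsup (\<lambda>n. ereal (dist y (u n))))"

lemma
  fixes u :: "nat \<Rightarrow> 'a::metric_space"
  assumes u: "bounded (range u)"
  shows ereal_limsup_dist: "ereal (limsup_dist u y) = limsup (\<lambda>n. ereal (dist y (u n)))"
    and limsup_dist_nonneg: "0 \<le> limsup_dist u y"
proof -
  obtain K where K: "\<And>n. dist y (u n) \<le> K"
    using u by (auto simp: bounded_any_center[of _ y])
  have le: "limsup (\<lambda>n. ereal (dist y (u n))) \<le> ereal K"
    by (intro Limsup_bounded always_eventually) (simp add: K)
  have ge: "0 \<le> limsup (\<lambda>n. ereal (dist y (u n)))"
    by (intro le_Limsup always_eventually) auto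
  from le ge have fin: "\<bar>limsup (\<lambda>n. ereal (dist y (u n)))\<bar> \<noteq> \<infinity>"
    by auto
  then show "ereal (limsup_dist u y) = limsup (\<lambda>n. ereal (dist y (u n)))"
    by (simp add: limsup_dist_def ereal_real')
  show "0 \<le> limsup_dist u y"
    using ge by (simp add: limsup_dist_def real_of_ereal_pos)
qed

lemma limsup_dist_leI:
  assumes u: "bounded (range u)" and "\<forall>\<^sub>F n in sequentially. dist y (u n) \<le> r"
  shows "limsup_dist u y \<le> r"
proof -
  have "ereal (limsup_dist u y) \<le> ereal r"
    unfolding ereal_limsup_dist[OF u] using assms(2) by (intro Limsup_bounded) simp
  then show ?thesis by simp
qed

lemma limsup_dist_eventually:
  assumes u: "bounded (range u)" and "limsup_dist u y < r"
  shows "\<forall>\<^sub>F n in sequentially. dist y (u n) < r"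
proof -
  have "limsup (\<lambda>n. ereal (dist y (u n))) < ereal r"
    using assms(2) by (simp flip: ereal_limsup_dist[OF u])
  from Limsup_lessD[OF this] show ?thesis by simp
qed

lemma asymptotic_centers_iff:
  assumes u: "bounded (range u)"
  shows "c \<in> asymptotic_centers u \<longleftrightarrow> (\<forall>y. limsup_dist u c \<le> limsup_dist u y)"
proof -
  have "c \<in> asymptotic_centers u \<longleftrightarrow>
      ereal (limsup_dist u c) = (INF y. ereal (limsup_dist u y))"
    by (simp add: asymptotic_centers_def asymptotic_radius_def ereal_limsup_dist[OF u])
  also have "\<dots> \<longleftrightarrow> ereal (limsup_dist u c) \<le> (INF y. ereal (limsup_dist u y))"
    by (auto intro: antisym INF_lower)
  also have "\<dots> \<longleftrightarrow> (\<forall>y. limsup_dist u c \<le> limsup_dist u y)"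
    by (simp add: le_INF_iff)
  finally show ?thesis .
qed

lemma limsup_dist_lipschitz:
  assumes u: "bounded (range u)"
  shows "limsup_dist u y \<le> limsup_dist u z + dist y z"
proof (rule field_le_epsilon)
  fix e :: real assume "0 < e"
  then have "\<forall>\<^sub>F n in sequentially. dist z (u n) < limsup_dist u z + e"
    by (intro limsup_dist_eventually[OF u]) simp
  then show "limsup_dist u y \<le> limsup_dist u z + dist y z + e"
  proof (intro limsup_dist_leI[OF u], eventually_elim)
    case (elim n)
    then show ?case using dist_triangle[of y "u n" z] by linarith
  qed
qed

lemma continuous_limsup_dist:
  assumes u: "bounded (range u)"
  shows "continuous_on S (limsup_dist u)"
  unfolding continuous_on_iff
proof (intro ballI allI impI)
  fix x and e :: real assume "0 < e"
  moreover have "dist (limsup_dist u y) (limsup_dist u x) \<le> dist y x" for y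
    using limsup_dist_lipschitz[OF u, of y x] limsup_dist_lipschitz[OF u, of x y]
    by (simp add: dist_real_def dist_commute abs_le_iff)
  ultimately show "\<exists>d>0. \<forall>y\<in>S. dist y x < d \<longrightarrow> dist (limsup_dist u y) (limsup_dist u x) < e"
    by (meson le_less_trans)
qed

text \<open>Strong convexity holds for each \<open>d(\<cdot>, u\<^sub>n)\<^sup>2\<close> with the same modulus and therefore passes to the
  limit superior. The slack \<open>e\<close> turns limits superior into eventual bounds and is sent to zero.\<close>

lemma strongly_convex_limsup_dist_squared:
  assumes u: "bounded (range u)"
  shows "strongly_convex_on C (\<lambda>y. (limsup_dist u y)\<^sup>2)"
  unfolding strongly_convex_on_def
proof (intro ballI)
  fix y z :: 'a and t :: real assume "t \<in> {0..1}"
  then have t: "0 \<le> t" "t \<le> 1" by auto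
  define h where "h e = (1 - t) * (limsup_dist u y + e)\<^sup>2 + t * (limsup_dist u z + e)\<^sup>2
      - t * (1 - t) * (dist y z)\<^sup>2" for e
  define m where "m = geodesic_point t y z"
  have le: "(limsup_dist u m)\<^sup>2 \<le> h e" if e: "0 < e" for e
  proof -
    have "\<forall>\<^sub>F n in sequentially. dist y (u n) < limsup_dist u y + e"
      "\<forall>\<^sub>F n in sequentially. dist z (u n) < limsup_dist u z + e"
      using e by (auto intro!: limsup_dist_eventually[OF u])
    then have ev: "\<forall>\<^sub>F n in sequentially. (dist m (u n))\<^sup>2 \<le> h e"
    proof eventually_elim
      case (elim n)
      have "(dist m (u n))\<^sup>2 \<le>
          (1 - t) * (dist y (u n))\<^sup>2 + t * (dist z (u n))\<^sup>2 - t * (1 - t) * (dist y z)\<^sup>2"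
        using CAT0_geodesic_point[OF t, of "u n" y z] by (simp add: m_def dist_commute)
      also have "\<dots> \<le> h e"
        unfolding h_def using elim t
        by (intro diff_right_mono add_mono mult_left_mono power_mono) auto
      finally show ?case .
    qed
    then have "0 \<le> h e"
      using eventually_happens'[OF sequentially_bot] zero_le_power2 order_trans by blast
    moreover have "limsup_dist u m \<le> sqrt (h e)"
      using ev by (intro limsup_dist_leI[OF u]) (auto elim!: eventually_mono intro: real_le_rsqrt)
    ultimately show ?thesis
      using power_mono[OF _ limsup_dist_nonneg[OF u], of m "sqrt (h e)" 2] by simp
  qed
  have "(h \<longlongrightarrow> h 0) (at_right 0)"
    unfolding h_def by (auto intro!: tendsto_eq_intros)
  then have "(limsup_dist u m)\<^sup>2 \<le> h 0"
    by (rule tendsto_lowerbound) (auto simp: eventually_at_right_less intro: eventually_mono[OF eventually_at_right_less] le)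
  then show "(limsup_dist u (geodesic_point t y z))\<^sup>2 \<le>
      (1 - t) * (limsup_dist u y)\<^sup>2 + t * (limsup_dist u z)\<^sup>2 - t * (1 - t) * (dist y z)\<^sup>2"
    by (simp add: m_def h_def)
qed

lemma asymptotic_centers_singleton:
  fixes u :: "nat \<Rightarrow> 'a::{CAT0_space, complete_space}"
  assumes u: "bounded (range u)"
  obtains c where "asymptotic_centers u = {c}"
proof -
  let ?g = "\<lambda>y. (limsup_dist u y)\<^sup>2"
  obtain c where c: "\<And>w. ?g c \<le> ?g w"
    by (rule strongly_convex_minimizer_exists[OF geodesically_convex_UNIV closed_UNIV UNIV_not_empty
          strongly_convex_limsup_dist_squared[OF u]])
      (auto intro!: continuous_intros continuous_limsup_dist[OF u] bdd_belowI[where m = 0])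
  have "c \<in> asymptotic_centers u"
    using c power2_le_imp_le limsup_dist_nonneg[OF u] by (auto simp: asymptotic_centers_iff[OF u])
  moreover have "z = c" if "z \<in> asymptotic_centers u" for z
  proof -
    have "?g z \<le> ?g c"
      using that limsup_dist_nonneg[OF u] by (auto simp: asymptotic_centers_iff[OF u] intro: power_mono)
    moreover have "?g c + (dist c z)\<^sup>2 \<le> ?g z"
      using c by (intro strongly_convex_minimizer_growth[OF geodesically_convex_UNIV
            strongly_convex_limsup_dist_squared[OF u]]) auto
    ultimately have "(dist c z)\<^sup>2 \<le> 0" by linarith
    then show ?thesis by simp
  qed
  ultimately have "asymptotic_centers u = {c}" by blast
  then show thesis by (rule that)
qed


section \<open>Picard iterations of nonexpansive maps\<close>

text \<open>The distance from \<open>T c\<close> to \<open>u n\<close> exceeds that from \<open>c\<close> by at most the displacement of \<open>u n\<close>,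
  so \<open>T c\<close> is an asymptotic center too, and asymptotic centers are unique.\<close>

lemma asymptotic_center_fixed:
  fixes u :: "nat \<Rightarrow> 'a::{CAT0_space, complete_space}"
  assumes u: "bounded (range u)" and T: "\<And>x y. dist (T x) (T y) \<le> dist x y"
    and reg: "(\<lambda>n. dist (u n) (T (u n))) \<longlonglongrightarrow> 0" and c: "c \<in> asymptotic_centers u"
  shows "T c = c"
proof -
  have "limsup_dist u (T c) \<le> limsup_dist u c"
  proof (rule field_le_epsilon)
    fix e :: real assume e: "0 < e"
    have "\<forall>\<^sub>F n in sequentially. dist (u n) (T (u n)) < e / 2"
      using order_tendstoD(2)[OF reg half_gt_zero[OF e]] .
    moreover have "\<forall>\<^sub>F n in sequentially. dist c (u n) < limsup_dist u c + e / 2"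
      using e by (intro limsup_dist_eventually[OF u]) simp
    ultimately show "limsup_dist u (T c) \<le> limsup_dist u c + e"
    proof (intro limsup_dist_leI[OF u], eventually_elim)
      case (elim n)
      then show ?case using dist_triangle2[of "T c" "u n" "T (u n)"] T[of c "u n"] by linarith
    qed
  qed
  with c have "T c \<in> asymptotic_centers u"
    unfolding asymptotic_centers_iff[OF u] using order_trans by blast
  with c asymptotic_centers_singleton[OF u] show ?thesis by (metis singletonD)
qed

lemma limsup_dist_subseq_le:
  assumes u: "bounded (range u)" and s: "strict_mono s"
  shows "limsup_dist (u \<circ> s) y \<le> limsup_dist u y"
proof -
  have us: "bounded (range (u \<circ> s))"
    using u by (rule bounded_subset) auto
  have "ereal (limsup_dist (u \<circ> s) y) \<le> ereal (limsup_dist u y)"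
    unfolding ereal_limsup_dist[OF u] ereal_limsup_dist[OF us]
    using limsup_subseq_mono[OF s, of "\<lambda>n. ereal (dist y (u n))"] by (simp add: comp_def)
  then show ?thesis by simp
qed

text \<open>Along a decreasing sequence of distances the limit superior is a limit, which subsequences
  share.\<close>

lemma limsup_dist_subseq_eq:
  assumes u: "bounded (range u)" and s: "strict_mono s"
    and dec: "\<And>n. dist y (u (Suc n)) \<le> dist y (u n)"
  shows "limsup_dist (u \<circ> s) y = limsup_dist u y"
proof -
  have us: "bounded (range (u \<circ> s))"
    using u by (rule bounded_subset) auto
  have "decseq (\<lambda>n. dist y (u n))" using dec by (rule decseq_SucI)
  then obtain r where r: "(\<lambda>n. dist y (u n)) \<longlonglongrightarrow> r"
    using decseq_convergent[of "\<lambda>n. dist y (u n)" 0] by auto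
  then have e: "(\<lambda>n. ereal (dist y (u n))) \<longlonglongrightarrow> ereal r" by simp
  have "limsup (\<lambda>n. ereal (dist y (u n))) = ereal r"
    using e by (intro lim_imp_Limsup) auto
  moreover have "limsup (\<lambda>n. ereal (dist y ((u \<circ> s) n))) = ereal r"
    using LIMSEQ_subseq_LIMSEQ[OF e s] by (intro lim_imp_Limsup) (auto simp: comp_def)
  ultimately show ?thesis by (simp add: limsup_dist_def)
qed

text \<open>An argument in the manner of Opial. The center \<open>c\<close> of a subsequence is fixed, so its
  asymptotic distance to the whole sequence equals that to the subsequence. The latter is minimal
  at \<open>c\<close>, and passing to a subsequence only decreases asymptotic distances; hence \<open>c\<close> is the center
  of the whole sequence.\<close>

lemma nonexpansive_Picard_Delta_converges:
  fixes T :: "'a::{CAT0_space, complete_space} \<Rightarrow> 'a"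
  assumes T: "\<And>x y. dist (T x) (T y) \<le> dist x y" and fixed: "T q = q"
    and reg: "(\<lambda>n. dist ((T ^^ n) x) (T ((T ^^ n) x))) \<longlonglongrightarrow> 0"
  obtains p where "T p = p" "Delta_converges (\<lambda>n. (T ^^ n) x) p"
proof -
  define u where "u n = (T ^^ n) x" for n
  have dec: "dist y (u (Suc n)) \<le> dist y (u n)" if "T y = y" for y n
    using T[of y "u n"] that by (simp add: u_def)
  have "dist q (u n) \<le> dist q (u 0)" for n
    by (induction n) (use dec[OF fixed] order_trans in blast)+
  then have u: "bounded (range u)"
    by (auto simp: bounded_any_center[of _ q])
  have center_fixed: "T c = c" if "strict_mono s" "c \<in> asymptotic_centers (u \<circ> s)" for s c
  proof (rule asymptotic_center_fixed[OF _ T _ that(2)])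
    show "bounded (range (u \<circ> s))"
      using u by (rule bounded_subset) auto
    show "(\<lambda>n. dist ((u \<circ> s) n) (T ((u \<circ> s) n))) \<longlonglongrightarrow> 0"
      using LIMSEQ_subseq_LIMSEQ[OF reg that(1)] by (simp add: comp_def u_def)
  qed
  obtain p where p: "asymptotic_centers u = {p}"
    using asymptotic_centers_singleton[OF u] .
  have "T p = p"
    using center_fixed[of id p] p by (simp add: strict_mono_def)
  moreover have "asymptotic_centers (u \<circ> s) = {p}" if s: "strict_mono s" for s
  proof -
    have us: "bounded (range (u \<circ> s))"
      using u by (rule bounded_subset) auto
    obtain c where c: "asymptotic_centers (u \<circ> s) = {c}"
      using asymptotic_centers_singleton[OF us] .
    then have c': "c \<in> asymptotic_centers (u \<circ> s)" by simp
    have "limsup_dist u c \<le> limsup_dist u y" for y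
    proof -
      have "limsup_dist u c = limsup_dist (u \<circ> s) c"
        using limsup_dist_subseq_eq[OF u s dec[OF center_fixed[OF s c']]] by simp
      also have "\<dots> \<le> limsup_dist (u \<circ> s) y"
        using c' by (simp add: asymptotic_centers_iff[OF us])
      also have "\<dots> \<le> limsup_dist u y"
        using limsup_dist_subseq_le[OF u s] .
      finally show ?thesis .
    qed
    then have "c \<in> asymptotic_centers u"
      by (simp add: asymptotic_centers_iff[OF u])
    with p c show ?thesis by simp
  qed
  ultimately show thesis
    using u that by (auto simp: Delta_converges_def u_def[abs_def])
qed


section \<open>Averaged projections\<close>

text \<open>An angle depends only on directions: if \<open>x\<close> lies on a geodesic from \<open>a\<close> to \<open>b\<close>, an obtuse angle
  at \<open>a\<close> between \<open>x\<close> and \<open>c\<close> is one between \<open>b\<close> and \<open>c\<close>. The position of \<open>x\<close> enters only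
  through the two numerical facts assumed of it, so that the lemma covers both ends of the geodesic,
  with \<open>a\<close> and \<open>b\<close> exchanged and \<open>t\<close> replaced by \<open>1 - t\<close>.\<close>

lemma obtuse_angle_extends:
  fixes a b c x :: "'a::metric_space"
  assumes t: "0 < t"
    and x: "dist x a = t * dist a b"
      "(dist x c)\<^sup>2 \<le> (1 - t) * (dist a c)\<^sup>2 + t * (dist b c)\<^sup>2 - t * (1 - t) * (dist a b)\<^sup>2"
    and obtuse: "(dist x a)\<^sup>2 + (dist a c)\<^sup>2 \<le> (dist x c)\<^sup>2"
  shows "(dist a b)\<^sup>2 + (dist a c)\<^sup>2 \<le> (dist b c)\<^sup>2"
proof -
  have "t\<^sup>2 * (dist a b)\<^sup>2 + (dist a c)\<^sup>2 \<le>
      (1 - t) * (dist a c)\<^sup>2 + t * (dist b c)\<^sup>2 - t * (1 - t) * (dist a b)\<^sup>2"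
    using obtuse x(2) unfolding x(1) power_mult_distrib by linarith
  then have "t * ((dist a b)\<^sup>2 + (dist a c)\<^sup>2) \<le> t * (dist b c)\<^sup>2"
    by (simp add: algebra_simps power2_eq_square)
  then show ?thesis using t by simp
qed

text \<open>The obtuse angles at \<open>a\<close> and \<open>b\<close> bound the diagonals of the quadrilateral \<open>a, b, e, c\<close> from
  below; in the quadrilateral inequality the sides \<open>a c\<close> and \<open>b e\<close> then cancel, which leaves
  \<open>d(a, b) \<le> d(c, e)\<close>.\<close>

lemma mutual_projections_best_approx:
  fixes A B :: "'a::CAT0_space set"
  assumes a: "a \<in> A" "\<And>c. c \<in> A \<Longrightarrow> (dist a b)\<^sup>2 + (dist a c)\<^sup>2 \<le> (dist b c)\<^sup>2"
    and b: "b \<in> B" "\<And>e. e \<in> B \<Longrightarrow> (dist a b)\<^sup>2 + (dist b e)\<^sup>2 \<le> (dist a e)\<^sup>2"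
  shows "(a, b) \<in> best_approx_pairs A B"
proof -
  have "dist a b \<le> dist c e" if "c \<in> A" "e \<in> B" for c e
  proof -
    have "(dist a e)\<^sup>2 + (dist b c)\<^sup>2 \<le>
        (dist a b)\<^sup>2 + (dist a c)\<^sup>2 + (dist b e)\<^sup>2 + (dist c e)\<^sup>2"
      using quadrilateral_inequality[of a e b c] by (simp add: dist_commute)
    then have "(dist a b)\<^sup>2 \<le> (dist c e)\<^sup>2"
      using a(2)[OF that(1)] b(2)[OF that(2)] by linarith
    then show ?thesis by simp
  qed
  then have "dist a b \<le> setdist A B"
    using a(1) b(1) by (intro le_setdistI) auto
  with setdist_le_dist[OF a(1) b(1)] show ?thesis
    using a(1) b(1) by (simp add: best_approx_pairs_def)
qed

locale averaged_projections =
  fixes A B :: "'a::{CAT0_space, complete_space} set" and t :: real and T :: "'a \<Rightarrow> 'a"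
  assumes A: "geodesically_convex A" "closed A" "A \<noteq> {}"
    and B: "geodesically_convex B" "closed B" "B \<noteq> {}"
    and t: "0 < t" "t < 1"
    and T: "T x = geodesic_point t (metric_proj A x) (metric_proj B x)"
begin

lemma nonexpansive: "dist (T x) (T y) \<le> dist x y"
proof -
  have "(dist (T x) (T y))\<^sup>2 \<le> (1 - t) * (dist (metric_proj A x) (metric_proj A y))\<^sup>2
      + t * (dist (metric_proj B x) (metric_proj B y))\<^sup>2"
    unfolding T using t by (intro dist_geodesic_points_squared_le) auto
  also have "\<dots> \<le> (1 - t) * (dist x y)\<^sup>2 + t * (dist x y)\<^sup>2"
    using t by (intro add_mono mult_left_mono power_mono metric_proj_nonexpansive A B) auto
  also have "\<dots> = (dist x y)\<^sup>2" by algebra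
  finally show ?thesis by simp
qed

definition energy :: "'a \<Rightarrow> real" where
  "energy x = (1 - t) * (dist x (metric_proj A x))\<^sup>2 + t * (dist x (metric_proj B x))\<^sup>2"

text \<open>Let \<open>a\<close> and \<open>b\<close> be the feet of \<open>x\<close> and \<open>V = t (1 - t) d(a, b)\<^sup>2\<close>. The point \<open>T x\<close> divides the
  geodesic from \<open>a\<close> to \<open>b\<close>, so its weighted squared distances to \<open>a\<close> and \<open>b\<close> sum to \<open>V\<close>, and its
  own feet are at least as near: \<open>energy (T x) \<le> V\<close>. The CAT(0) inequality at \<open>x\<close> says that
  \<open>d(x, T x)\<^sup>2 \<le> energy x - V\<close>.\<close>

lemma energy_descent: "(dist x (T x))\<^sup>2 \<le> energy x - energy (T x)"
proof -
  define a b where "a = metric_proj A x" and "b = metric_proj B x"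
  have ab: "a \<in> A" "b \<in> B"
    unfolding a_def b_def by (intro metric_proj_in A B)+
  have Tx: "T x = geodesic_point t a b"
    by (simp add: T a_def b_def)
  have "energy (T x) \<le> (1 - t) * (dist (T x) a)\<^sup>2 + t * (dist (T x) b)\<^sup>2"
    unfolding energy_def using t ab
    by (intro add_mono mult_left_mono metric_proj_dist_le A B) auto
  also have "\<dots> = (1 - t) * (t * dist a b)\<^sup>2 + t * ((1 - t) * dist a b)\<^sup>2"
    using dist_geodesic_point_left[of t a b] dist_geodesic_point_right[of t b a] t
    by (simp add: Tx dist_commute)
  also have "\<dots> = t * (1 - t) * (dist a b)\<^sup>2" by algebra
  finally have "energy (T x) \<le> t * (1 - t) * (dist a b)\<^sup>2" .
  moreover have "(dist x (T x))\<^sup>2 \<le> energy x - t * (1 - t) * (dist a b)\<^sup>2"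
    using CAT0_geodesic_point[of t x a b] t by (simp add: Tx energy_def a_def b_def)
  ultimately show ?thesis by linarith
qed

lemma asymptotically_regular: "(\<lambda>n. dist ((T ^^ n) x) (T ((T ^^ n) x))) \<longlonglongrightarrow> 0"
proof -
  let ?u = "\<lambda>n. (T ^^ n) x"
  have sq: "(dist (?u n) (T (?u n)))\<^sup>2 \<le> energy (?u n) - energy (?u (Suc n))" for n
    using energy_descent[of "?u n"] by simp
  have "energy (?u (Suc n)) \<le> energy (?u n)" for n
    using sq[of n] zero_le_power2[of "dist (?u n) (T (?u n))"] by linarith
  then have "decseq (\<lambda>n. energy (?u n))" by (rule decseq_SucI)
  moreover have "0 \<le> energy y" for y
    using t by (simp add: energy_def)
  ultimately obtain l where l: "(\<lambda>n. energy (?u n)) \<longlonglongrightarrow> l"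
    using decseq_convergent[of "\<lambda>n. energy (?u n)" 0] by metis
  have "(\<lambda>n. energy (?u n) - energy (?u (Suc n))) \<longlonglongrightarrow> l - l"
    by (intro tendsto_diff l LIMSEQ_Suc)
  then have "(\<lambda>n. energy (?u n) - energy (?u (Suc n))) \<longlonglongrightarrow> 0" by simp
  then have "(\<lambda>n. (dist (?u n) (T (?u n)))\<^sup>2) \<longlonglongrightarrow> 0"
    by (rule tendsto_sandwich[OF _ _ tendsto_const, rotated 2]) (use sq in auto)
  from tendsto_real_sqrt[OF this] show ?thesis by simp
qed

text \<open>The geodesic point of a best approximation pair has \<open>a\<close> and \<open>b\<close> as its feet: a nearer point of
  either set would give, by the triangle inequality, a pair closer than \<open>(a, b)\<close>.\<close>

lemma fixed_of_best_approx:
  assumes "(a, b) \<in> best_approx_pairs A B"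
  shows "T (geodesic_point t a b) = geodesic_point t a b"
proof -
  let ?p = "geodesic_point t a b"
  have ab: "a \<in> A" "b \<in> B" and le: "\<And>c e. c \<in> A \<Longrightarrow> e \<in> B \<Longrightarrow> dist a b \<le> dist c e"
    using assms setdist_le_dist by (auto simp: best_approx_pairs_def)
  have p: "dist ?p a = t * dist a b" "dist ?p b = (1 - t) * dist a b"
    using dist_geodesic_point_left[of t a b] dist_geodesic_point_right[of t b a] t
    by (simp_all add: dist_commute)
  have "metric_proj A ?p = a"
  proof (rule metric_proj_eqI[OF A(1,2) ab(1)])
    fix c assume "c \<in> A"
    then have "dist a b \<le> dist c ?p + dist ?p b"
      using le[OF _ ab(2)] dist_triangle[of c b ?p] by fastforce
    then show "dist ?p a \<le> dist ?p c"
      unfolding p by (simp add: dist_commute algebra_simps)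
  qed
  moreover have "metric_proj B ?p = b"
  proof (rule metric_proj_eqI[OF B(1,2) ab(2)])
    fix e assume "e \<in> B"
    then have "dist a b \<le> dist a ?p + dist ?p e"
      using le[OF ab(1)] dist_triangle[of a e ?p] by fastforce
    then show "dist ?p b \<le> dist ?p e"
      using p by (simp add: dist_commute algebra_simps)
  qed
  ultimately show ?thesis by (simp add: T)
qed

text \<open>A fixed point lies on the geodesic between its feet, so the obtuse angles at the feet extend
  along that geodesic and make the feet projections of each other.\<close>

lemma best_approx_of_fixed:
  assumes "T x = x"
  shows "(metric_proj A x, metric_proj B x) \<in> best_approx_pairs A B"
proof -
  define a b where "a = metric_proj A x" and "b = metric_proj B x"
  have x: "x = geodesic_point t a b"
    using assms by (simp add: T a_def b_def)
  have d: "dist x a = t * dist a b" "dist x b = (1 - t) * dist b a"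
    using dist_geodesic_point_left[of t a b] dist_geodesic_point_right[of t b a] t
    by (simp_all add: x dist_commute)
  have conv: "(dist x c)\<^sup>2 \<le> (1 - t) * (dist a c)\<^sup>2 + t * (dist b c)\<^sup>2 - t * (1 - t) * (dist a b)\<^sup>2"
    for c
    using CAT0_geodesic_point[of t c a b] t by (simp add: x dist_commute)
  have "(a, b) \<in> best_approx_pairs A B"
  proof (rule mutual_projections_best_approx)
    show "a \<in> A" "b \<in> B"
      unfolding a_def b_def by (intro metric_proj_in A B)+
    show "(dist a b)\<^sup>2 + (dist a c)\<^sup>2 \<le> (dist b c)\<^sup>2" if "c \<in> A" for c
      using t metric_proj_obtuse[OF A that, of x]
      by (intro obtuse_angle_extends[OF _ d(1) conv]) (simp_all add: a_def)
    show "(dist a b)\<^sup>2 + (dist b e)\<^sup>2 \<le> (dist a e)\<^sup>2" if "e \<in> B" for e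
    proof -
      have "(dist b a)\<^sup>2 + (dist b e)\<^sup>2 \<le> (dist a e)\<^sup>2"
        using t metric_proj_obtuse[OF B that, of x] conv[of e]
        by (intro obtuse_angle_extends[OF _ d(2)]) (simp_all add: b_def dist_commute algebra_simps)
      then show ?thesis by (simp add: dist_commute)
    qed
  qed
  then show ?thesis by (simp add: a_def b_def)
qed

end

theorem corollary3p5:
  fixes A B :: "'a::{CAT0_space, complete_space} set"
    and lam :: real
    and T :: "'a \<Rightarrow> 'a"
  assumes "geodesically_convex A" "closed A" "A \<noteq> {}"
    and "geodesically_convex B" "closed B" "B \<noteq> {}"
    and "0 < lam" "lam < 1"
    and "\<And>x. T x = geodesic_point lam (metric_proj A x) (metric_proj B x)"
    and "best_approx_pairs A B \<noteq> {}"
  shows "\<forall>x. \<exists>(a, b) \<in> best_approx_pairs A B.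
           Delta_converges (\<lambda>n. (T ^^ n) x) (geodesic_point lam a b)"
proof
  fix x
  interpret averaged_projections A B lam T
    using assms(1-9) by unfold_locales
  obtain a b where "(a, b) \<in> best_approx_pairs A B"
    using assms(10) by auto
  note fixed = fixed_of_best_approx[OF this]
  obtain p where p: "T p = p" "Delta_converges (\<lambda>n. (T ^^ n) x) p"
    by (rule nonexpansive_Picard_Delta_converges[OF nonexpansive fixed asymptotically_regular])
  then have "Delta_converges (\<lambda>n. (T ^^ n) x)
      (geodesic_point lam (metric_proj A p) (metric_proj B p))"
    by (simp flip: T)
  with best_approx_of_fixed[OF p(1)]
  show "\<exists>(a, b) \<in> best_approx_pairs A B.
      Delta_converges (\<lambda>n. (T ^^ n) x) (geodesic_point lam a b)"
    by blast
qed

end
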